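(* Let $0<q<1$ and let $\eta,\kappa,\sigma,c,\lambda\in\mathbb{C}$ with $\Re(\eta)>0$, $\Re(\kappa)>0$ and $\Re(c)>\Re(\sigma)>0$. Then for every $m\in\mathbb{N}$ and every $u\in\mathbb{C}\setminus\{0\}$ with $|\lambda u^{\eta}|<(1-q)^{-\Re(\eta)}$, $$D_q^m\left[u^{\kappa-1}E_{\eta,\kappa}^{(\sigma;c)}(\lambda u^\eta;q)\right]=u^{\kappa-m-1}E_{\eta,\kappa-m}^{(\sigma;c)}(\lambda u^\eta;q),$$ where $D_q^m$ is the $m$-fold iterate of the $q$-difference operator $D_q$ acting in the variable $u$.
   Context: Let $0<q<1$. For $\lambda\in\mathbb{C}$, $(\lambda;q)_0=1$, $(\lambda;q)_n=\prod_{i=0}^{n-1}(1-\lambda q^i)$ for $n\ge1$, and $(\lambda;q)_\infty=\prod_{i\ge0}(1-\lambda q^i)$. Complex powers are principal values. The $q$-gamma function is $\Gamma_q(z)=\frac{(q;q)_\infty}{(q^z;q)_\infty}(1-q)^{1-z}$; its reciprocal is entire, and at poles of $\Gamma_q$ the quantity $1/\Gamma_q(z)$ is read as $0$. The $q$-beta function is $B_q(a,b)=\frac{\Gamma_q(a)\Gamma_q(b)}{\Gamma_q(a+b)}$ for $\Re(a),\Re(b)>0$. The $q$-difference operator is $D_qf(u)=\frac{f(u)-f(uq)}{u(1-q)}$ for $u\ne0$. For $\Re(c)>\Re(\sigma)>0$ and $\Re(\eta)>0$ the extended $q$-Mittag-Leffler function is $$E_{\eta,\kappa}^{(\sigma;c)}(u;q)=\sum_{n=0}^\infty\frac{B_q(\sigma+n,c-\sigma)}{B_q(\sigma,c-\sigma)}\,\frac{(q^{c};q)_n}{(q;q)_n}\,\frac{u^n}{\Gamma_q(\eta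 n+\kappa)},$$ and the same series defines it when $\kappa$ is replaced by $\kappa-m$ (with $1/\Gamma_q(z)$ read as $0$ whenever $z$ is a pole of $\Gamma_q$). *)

theory Defs
  imports "HOL-Analysis.Analysis"
begin

definition q_pochhammer :: "real \<Rightarrow> complex \<Rightarrow> nat \<Rightarrow> complex" where
  "q_pochhammer q a n = (\<Prod>i<n. 1 - a * of_real q ^ i)"

definition q_pochhammer_inf :: "real \<Rightarrow> complex \<Rightarrow> complex" where
  "q_pochhammer_inf q a = (\<Prod>i. 1 - a * of_real q ^ i)"

text \<open>At a pole of the q-gamma function the denominator vanishes, so the value below is 0 and
  \<open>1 / q_Gamma q z\<close> is 0 there as well, which is the value of the entire reciprocal.\<close>

definition q_Gamma :: "real \<Rightarrow> complex \<Rightarrow> complex" where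
  "q_Gamma q z =
     q_pochhammer_inf q (of_real q) / q_pochhammer_inf q (of_real q powr z)
       * of_real (1 - q) powr (1 - z)"

text \<open>Meant for arguments with positive real part.\<close>

definition q_Beta :: "real \<Rightarrow> complex \<Rightarrow> complex \<Rightarrow> complex" where
  "q_Beta q a b = q_Gamma q a * q_Gamma q b / q_Gamma q (a + b)"

text \<open>The value at \<open>u = 0\<close> is irrelevant: iterates of the operator at \<open>u \<noteq> 0\<close> only evaluate
  the function at the nonzero points \<open>u * q ^ k\<close>.\<close>

definition q_diff :: "real \<Rightarrow> (complex \<Rightarrow> complex) \<Rightarrow> complex \<Rightarrow> complex" where
  "q_diff q f u = (f u - f (u * of_real q)) / (u * of_real (1 - q))"

definition q_Mittag_Leffler ::
  "real \<Rightarrow> complex \<Rightarrow> complex \<Rightarrow> complex \<Rightarrow> complex \<Rightarrow> complex \<Rightarrow> complex" where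
  "q_Mittag_Leffler q \<eta> \<kappa> \<sigma> c u =
     (\<Sum>n. q_Beta q (\<sigma> + of_nat n) (c - \<sigma>) / q_Beta q \<sigma> (c - \<sigma>)
            * (q_pochhammer q (of_real q powr c) n / q_pochhammer q (of_real q) n)
            * (u ^ n / q_Gamma q (\<eta> * of_nat n + \<kappa>)))"

end

theory Submission
  imports Defs
begin

text \<open>The factor \<open>v powr (\<kappa> - 1)\<close> combines with the \<open>n\<close>-th power of \<open>l * v powr \<eta>\<close> to
  \<open>v powr (\<eta> n + \<kappa> - 1)\<close>.  Since \<open>q\<close> is a positive real, \<open>v powr s\<close> is multiplied by \<open>q powr s\<close>
  when \<open>v\<close> is replaced by \<open>v q\<close>, with no correction from the branch of the logarithm, so every
  such power is an eigenvector of the dilation, and \<open>q_diff\<close> lowers its exponent by one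
  and multiplies it by \<open>(1 - q powr s) / (1 - q)\<close>.  For \<open>s = z - 1\<close> with \<open>z = \<eta> n + \<kappa>\<close> this is
  exactly the factor by which \<open>1 / \<Gamma>\<^sub>q(z - 1)\<close> differs from \<open>1 / \<Gamma>\<^sub>q(z)\<close>
  (\<open>inverse_q_Gamma_minus_1\<close>), an identity between entire functions that also holds at the
  poles of \<open>\<Gamma>\<^sub>q\<close>.  So one application of \<open>q_diff\<close> lowers \<open>\<kappa>\<close> by one.

  Termwise application needs the series to converge at \<open>v\<close> and at \<open>v q\<close>.  The quotients of
  beta values and of \<open>q\<close>-shifted factorials are bounded in \<open>n\<close> (\<open>Bseq_Mittag_Leffler_coeff\<close>),
  and \<open>1 / \<Gamma>\<^sub>q(\<eta> n + \<kappa>)\<close> is at most a constant times the \<open>n\<close>-th power of \<open>(1 - q) powr Re \<eta>\<close>, so the series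
  is dominated by a geometric one in the stated disc, for \<open>\<kappa>\<close> and for each \<open>\<kappa> - m\<close> alike
  (\<open>summable_q_Mittag_Leffler\<close>).  The disc condition
  is inherited by \<open>v q\<close>, and the iterate follows by induction on \<open>m\<close> for all such points.\<close>

context
  fixes q :: real
  assumes q_pos: "0 < q" and q_less_1: "q < 1"
begin

section \<open>Shifted factorials and the gamma function\<close>

lemma convergent_prod_q_pochhammer:
  "convergent_prod (\<lambda>i. 1 - a * of_real q ^ i :: complex)"
proof -
  have "summable (\<lambda>i. norm a * q ^ i)"
    using q_pos q_less_1 by (intro summable_mult summable_geometric) auto
  hence "summable (\<lambda>i. norm ((1 - a * of_real q ^ i) - 1))"
    using q_pos by (simp add: norm_mult norm_power)
  thus ?thesis
    by (intro abs_convergent_prod_imp_convergent_prod summable_imp_abs_convergent_prod)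
qed

lemma q_pochhammer_LIMSEQ: "q_pochhammer q a \<longlonglongrightarrow> q_pochhammer_inf q a"
proof -
  have "(\<lambda>n. q_pochhammer q a (Suc n)) \<longlonglongrightarrow> q_pochhammer_inf q a"
    using convergent_prod_LIMSEQ[OF convergent_prod_q_pochhammer[of a]]
    by (simp add: q_pochhammer_def q_pochhammer_inf_def lessThan_Suc_atMost)
  thus ?thesis by (rule LIMSEQ_imp_Suc)
qed

lemma q_pochhammer_inf_shift:
  "q_pochhammer_inf q a = (1 - a) * q_pochhammer_inf q (a * of_real q)"
proof -
  have "q_pochhammer q a (Suc n) = (1 - a) * q_pochhammer q (a * of_real q) n" for n
    by (simp add: q_pochhammer_def prod.lessThan_Suc_shift mult_ac del: prod.lessThan_Suc)
  hence "(\<lambda>n. q_pochhammer q a (Suc n)) \<longlonglongrightarrow> (1 - a) * q_pochhammer_inf q (a * of_real q)"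
    by (auto intro!: tendsto_mult_left q_pochhammer_LIMSEQ)
  with LIMSEQ_Suc[OF q_pochhammer_LIMSEQ[of a]] show ?thesis
    by (rule LIMSEQ_unique)
qed

lemma q_pochhammer_inf_split:
  "q_pochhammer_inf q a = q_pochhammer q a n * q_pochhammer_inf q (a * of_real q ^ n)"
proof (induction n)
  case 0
  show ?case by (simp add: q_pochhammer_def)
next
  case (Suc n)
  thus ?case
    by (subst (asm) q_pochhammer_inf_shift[of "a * of_real q ^ n"])
       (simp add: q_pochhammer_def mult_ac)
qed

lemma q_pochhammer_inf_nonzero:
  assumes "norm a < 1"
  shows "q_pochhammer_inf q a \<noteq> 0"
  unfolding q_pochhammer_inf_def
proof (rule prodinf_nonzero[OF convergent_prod_q_pochhammer])
  fix i
  have "norm (a * of_real q ^ i) \<le> norm a * 1"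
    unfolding norm_mult using q_pos q_less_1
    by (intro mult_left_mono) (auto simp: norm_power power_le_one)
  with assms have "norm (a * of_real q ^ i) < 1" by simp
  thus "1 - a * of_real q ^ i \<noteq> 0" by (metis eq_iff_diff_eq_0 norm_one less_irrefl)
qed

text \<open>From \<open>\<bar>1 - x\<bar> \<le> exp \<bar>x\<bar>\<close> and the geometric series.\<close>

lemma norm_q_pochhammer_le:
  assumes "norm a \<le> R"
  shows "norm (q_pochhammer q a n) \<le> exp (R / (1 - q))"
proof -
  have "norm (q_pochhammer q a n) = (\<Prod>i<n. norm (1 - a * of_real q ^ i))"
    by (simp add: q_pochhammer_def prod_norm)
  also have "\<dots> \<le> (\<Prod>i<n. 1 + norm a * q ^ i)"
  proof (intro prod_mono conjI)
    fix i
    show "norm (1 - a * of_real q ^ i) \<le> 1 + norm a * q ^ i"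
      using norm_triangle_ineq4[of 1 "a * of_real q ^ i"] q_pos
      by (simp add: norm_mult norm_power)
  qed auto
  also have "\<dots> \<le> exp (\<Sum>i<n. norm a * q ^ i)"
    using q_pos by (intro prod_le_exp_sum) auto
  also have "(\<Sum>i<n. norm a * q ^ i) \<le> norm a * (1 / (1 - q))"
    unfolding sum_distrib_left[symmetric] using q_pos q_less_1
    by (intro mult_left_mono) (auto simp: sum_gp_strict divide_right_mono)
  also have "\<dots> \<le> R / (1 - q)"
    using assms q_less_1 by (simp add: divide_right_mono)
  finally show ?thesis by simp
qed

lemma norm_q_pochhammer_inf_le:
  assumes "norm a \<le> R"
  shows "norm (q_pochhammer_inf q a) \<le> exp (R / (1 - q))"
  by (rule LIMSEQ_le_const2[OF tendsto_norm[OF q_pochhammer_LIMSEQ]])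
     (use norm_q_pochhammer_le[OF assms] in blast)

lemma Bseq_q_pochhammer: "Bseq (\<lambda>n. q_pochhammer q a n)"
  using norm_q_pochhammer_le[OF order_refl] by (rule BseqI')

lemma Bseq_q_pochhammer_inf_mult_power: "Bseq (\<lambda>n. q_pochhammer_inf q (a * of_real q ^ n))"
proof (rule BseqI')
  fix n
  have "norm (a * of_real q ^ n) \<le> norm a * 1"
    unfolding norm_mult using q_pos q_less_1
    by (intro mult_left_mono) (auto simp: norm_power power_le_one)
  thus "norm (q_pochhammer_inf q (a * of_real q ^ n)) \<le> exp (norm a / (1 - q))"
    by (intro norm_q_pochhammer_inf_le) simp
qed

text \<open>Upper bounds for shifted factorials are also lower bounds: a finite factorial and the
  complementary infinite one have a constant product.\<close>

lemma Bseq_inverse_q_pochhammer: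
  assumes "norm a < 1"
  shows "Bseq (\<lambda>n. inverse (q_pochhammer q a n))"
proof -
  have "inverse (q_pochhammer q a n)
      = inverse (q_pochhammer_inf q a) * q_pochhammer_inf q (a * of_real q ^ n)" for n
    using q_pochhammer_inf_split[of a n] q_pochhammer_inf_nonzero[OF assms]
    by (auto simp: field_simps)
  thus ?thesis
    by (simp add: Bseq_mult Bfun_const Bseq_q_pochhammer_inf_mult_power)
qed

lemma Bseq_inverse_q_pochhammer_inf_mult_power:
  assumes "norm a < 1"
  shows "Bseq (\<lambda>n. inverse (q_pochhammer_inf q (a * of_real q ^ n)))"
proof -
  have "inverse (q_pochhammer_inf q (a * of_real q ^ n))
      = inverse (q_pochhammer_inf q a) * q_pochhammer q a n" for n
    using q_pochhammer_inf_split[of a n] q_pochhammer_inf_nonzero[OF assms]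
    by (auto simp: field_simps)
  thus ?thesis
    by (simp add: Bseq_mult Bfun_const Bseq_q_pochhammer)
qed

lemma inverse_q_Gamma:
  "inverse (q_Gamma q z) = q_pochhammer_inf q (of_real q powr z) / q_pochhammer_inf q (of_real q)
     * of_real (1 - q) powr (z - 1)"
proof -
  have "inverse (of_real (1 - q) powr (1 - z)) = (of_real (1 - q) :: complex) powr (z - 1)"
    by (metis minus_diff_eq powr_minus)
  thus ?thesis by (simp add: q_Gamma_def divide_inverse mult_ac)
qed

text \<open>The functional equation \<open>\<Gamma>\<^sub>q(z) = (1 - q powr (z - 1)) / (1 - q) \<Gamma>\<^sub>q(z - 1)\<close>, stated for
  the entire reciprocal so that it also covers the poles.\<close>

lemma inverse_q_Gamma_minus_1:
  "inverse (q_Gamma q (z - 1))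
     = (1 - of_real q powr (z - 1)) / of_real (1 - q) * inverse (q_Gamma q z)"
proof -
  have "(of_real q :: complex) powr (z - 1) * of_real q = of_real q powr z"
    using q_pos by (simp add: powr_diff)
  moreover have "(of_real (1 - q) :: complex) powr (z - 1 - 1)
      = of_real (1 - q) powr (z - 1) / of_real (1 - q)"
    using q_less_1 by (subst powr_diff) (auto simp flip: of_real_diff)
  ultimately show ?thesis
    unfolding inverse_q_Gamma by (subst q_pochhammer_inf_shift) (simp add: mult_ac)
qed

section \<open>Convergence of the Mittag-Leffler series\<close>

definition Mittag_Leffler_coeff :: "complex \<Rightarrow> complex \<Rightarrow> nat \<Rightarrow> complex" where
  "Mittag_Leffler_coeff \<sigma> c n = q_Beta q (\<sigma> + of_nat n) (c - \<sigma>) / q_Beta q \<sigma> (c - \<sigma>)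
     * (q_pochhammer q (of_real q powr c) n / q_pochhammer q (of_real q) n)"

lemma q_Mittag_Leffler_eq:
  "q_Mittag_Leffler q \<eta> \<kappa> \<sigma> c x
     = (\<Sum>n. Mittag_Leffler_coeff \<sigma> c n * (x ^ n * inverse (q_Gamma q (\<eta> * of_nat n + \<kappa>))))"
  by (simp add: q_Mittag_Leffler_def Mittag_Leffler_coeff_def divide_inverse)

text \<open>In \<open>\<Gamma>\<^sub>q(\<sigma> + n) / \<Gamma>\<^sub>q(c + n)\<close> the powers of \<open>1 - q\<close> combine to one that does not depend on
  \<open>n\<close>, so only shifted factorials of arguments \<open>a q\<^sup>n\<close> have to be controlled.\<close>

lemma Bseq_Mittag_Leffler_coeff:
  assumes "Re \<sigma> > 0"
  shows "Bseq (Mittag_Leffler_coeff \<sigma> c)"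
proof -
  have powr_add_nat: "(of_real q :: complex) powr (z + of_nat n) = of_real q powr z * of_real q ^ n"
    for z n using q_pos by (simp add: powr_add powr_complexpow)
  define s C where "s = (of_real q :: complex) powr \<sigma>" and "C = (of_real q :: complex) powr c"
  define K where "K = q_Gamma q (c - \<sigma>) / q_Beta q \<sigma> (c - \<sigma>) * of_real (1 - q) powr (c - \<sigma>)"
  have s: "norm s < 1"
    using q_pos q_less_1 assms by (simp add: s_def norm_powr_real_powr powr01_less_one)
  have P: "q_pochhammer_inf q (of_real q) \<noteq> 0"
    using q_pos q_less_1 by (intro q_pochhammer_inf_nonzero) auto
  have "q_Beta q (\<sigma> + of_nat n) (c - \<sigma>) / q_Beta q \<sigma> (c - \<sigma>)
      = K * (inverse (q_pochhammer_inf q (s * of_real q ^ n))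
             * q_pochhammer_inf q (C * of_real q ^ n))" for n
  proof -
    have "(of_real (1 - q) :: complex) powr (1 - (\<sigma> + of_nat n))
            * of_real (1 - q) powr (c + of_nat n - 1) = of_real (1 - q) powr (c - \<sigma>)"
      by (simp add: algebra_simps flip: powr_add)
    hence "q_Gamma q (\<sigma> + of_nat n) * inverse (q_Gamma q (c + of_nat n))
        = inverse (q_pochhammer_inf q (s * of_real q ^ n)) * q_pochhammer_inf q (C * of_real q ^ n)
          * of_real (1 - q) powr (c - \<sigma>)"
      unfolding inverse_q_Gamma using P
      by (simp add: q_Gamma_def powr_add_nat s_def C_def divide_inverse mult_ac)
    moreover have "\<sigma> + of_nat n + (c - \<sigma>) = c + of_nat n" by simp
    ultimately show ?thesis
      unfolding q_Beta_def[of q "\<sigma> + of_nat n"] K_def divide_inverse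
      by (simp add: mult_ac add_ac)
  qed
  hence "Mittag_Leffler_coeff \<sigma> c = (\<lambda>n. K * (inverse (q_pochhammer_inf q (s * of_real q ^ n))
             * q_pochhammer_inf q (C * of_real q ^ n))
           * (q_pochhammer q C n * inverse (q_pochhammer q (of_real q) n)))"
    by (auto simp: Mittag_Leffler_coeff_def C_def divide_inverse)
  moreover have "Bseq \<dots>"
    using q_pos q_less_1 s
    by (intro Bseq_mult Bfun_const Bseq_q_pochhammer Bseq_inverse_q_pochhammer
        Bseq_q_pochhammer_inf_mult_power Bseq_inverse_q_pochhammer_inf_mult_power) auto
  ultimately show ?thesis by metis
qed

text \<open>The factorial in \<open>1 / \<Gamma>\<^sub>q(\<eta> n + \<kappa>)\<close> stays bounded because its argument
  \<open>q powr (\<eta> n + \<kappa>)\<close> never exceeds \<open>q powr Re \<kappa>\<close> in modulus; the rate comes from the power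
  of \<open>1 - q\<close> alone, and it is what fixes the radius of the disc.\<close>

lemma norm_inverse_q_Gamma_le:
  assumes "Re \<eta> \<ge> 0"
  obtains B where "\<And>n. norm (inverse (q_Gamma q (\<eta> * of_nat n + \<kappa>))) \<le> B * ((1 - q) powr Re \<eta>) ^ n"
proof
  fix n :: nat
  let ?P = "norm (q_pochhammer_inf q (of_real q))"
  have "norm ((of_real q :: complex) powr (\<eta> * of_nat n + \<kappa>)) = q powr (Re \<eta> * real n + Re \<kappa>)"
    using q_pos by (simp add: norm_powr_real_powr)
  also have "\<dots> \<le> q powr Re \<kappa>"
    using q_pos q_less_1 assms by (intro powr_mono') auto
  finally have *: "norm (q_pochhammer_inf q (of_real q powr (\<eta> * of_nat n + \<kappa>)))
      \<le> exp (q powr Re \<kappa> / (1 - q))"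
    by (rule norm_q_pochhammer_inf_le)
  have "norm ((of_real (1 - q) :: complex) powr (\<eta> * of_nat n + \<kappa> - 1))
      = (1 - q) powr (Re \<eta> * real n + (Re \<kappa> - 1))"
    using q_less_1 by (subst norm_powr_real_powr) (auto simp: algebra_simps)
  also have "\<dots> = ((1 - q) powr Re \<eta>) ^ n * (1 - q) powr (Re \<kappa> - 1)"
    using q_less_1 by (simp add: powr_add powr_powr powr_realpow flip: powr_powr)
  finally have "norm (inverse (q_Gamma q (\<eta> * of_nat n + \<kappa>)))
      = norm (q_pochhammer_inf q (of_real q powr (\<eta> * of_nat n + \<kappa>))) / ?P
        * (((1 - q) powr Re \<eta>) ^ n * (1 - q) powr (Re \<kappa> - 1))"
    unfolding inverse_q_Gamma norm_mult norm_divide by simp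
  also have "\<dots> \<le> exp (q powr Re \<kappa> / (1 - q)) / ?P
        * (((1 - q) powr Re \<eta>) ^ n * (1 - q) powr (Re \<kappa> - 1))"
    using * by (intro mult_right_mono divide_right_mono) auto
  finally show "norm (inverse (q_Gamma q (\<eta> * of_nat n + \<kappa>)))
      \<le> exp (q powr Re \<kappa> / (1 - q)) / ?P * (1 - q) powr (Re \<kappa> - 1) * ((1 - q) powr Re \<eta>) ^ n"
    by (simp add: mult_ac)
qed

lemma summable_q_Mittag_Leffler:
  assumes "Re \<eta> \<ge> 0" "Re \<sigma> > 0" "norm x < (1 - q) powr (- Re \<eta>)"
  shows "summable (\<lambda>n. Mittag_Leffler_coeff \<sigma> c n * (x ^ n * inverse (q_Gamma q (\<eta> * of_nat n + \<kappa>))))"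
proof -
  let ?r = "(1 - q) powr Re \<eta>"
  obtain A where A: "A > 0" "\<And>n. norm (Mittag_Leffler_coeff \<sigma> c n) \<le> A"
    using Bseq_Mittag_Leffler_coeff[OF assms(2)] by (auto simp: Bseq_def)
  obtain B where B: "\<And>n. norm (inverse (q_Gamma q (\<eta> * of_nat n + \<kappa>))) \<le> B * ?r ^ n"
    using norm_inverse_q_Gamma_le[OF assms(1)] by blast
  have "norm x * ?r < 1"
    using assms(3) q_less_1 by (simp add: powr_minus field_simps)
  hence "summable (\<lambda>n. A * B * (norm x * ?r) ^ n)"
    by (intro summable_mult summable_geometric) (auto simp: abs_mult)
  thus ?thesis
  proof (rule summable_comparison_test')
    fix n
    have "norm (Mittag_Leffler_coeff \<sigma> c n * (x ^ n * inverse (q_Gamma q (\<eta> * of_nat n + \<kappa>))))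
        \<le> A * (norm x ^ n * (B * ?r ^ n))"
      unfolding norm_mult norm_power using A B by (intro mult_mono) auto
    thus "norm (Mittag_Leffler_coeff \<sigma> c n * (x ^ n * inverse (q_Gamma q (\<eta> * of_nat n + \<kappa>))))
        \<le> A * B * (norm x * ?r) ^ n"
      by (simp add: power_mult_distrib mult_ac)
  qed
qed

section \<open>The difference operator on powers and on the series\<close>

lemma q_powr_mult: "(u * of_real q :: complex) powr s = u powr s * of_real q powr s"
  using powr_times_real_left[of "of_real q" u s] q_pos by (simp add: mult.commute)

lemma q_diff_powr:
  assumes "u \<noteq> 0"
  shows "q_diff q (\<lambda>v. v powr s) u = (1 - of_real q powr s) / of_real (1 - q) * u powr (s - 1)"
  using assms by (simp add: q_diff_def q_powr_mult powr_diff)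
    (simp add: algebra_simps flip: times_divide_eq_left)

lemma q_diff_q_Mittag_Leffler:
  assumes "Re \<eta> \<ge> 0" "Re \<sigma> > 0" "u \<noteq> 0"
    and "norm (l * u powr \<eta>) < (1 - q) powr (- Re \<eta>)"
    and "norm (l * (u * of_real q) powr \<eta>) < (1 - q) powr (- Re \<eta>)"
  shows "q_diff q (\<lambda>v. v powr (\<kappa> - 1) * q_Mittag_Leffler q \<eta> \<kappa> \<sigma> c (l * v powr \<eta>)) u
     = u powr (\<kappa> - 1 - 1) * q_Mittag_Leffler q \<eta> (\<kappa> - 1) \<sigma> c (l * u powr \<eta>)"
proof -
  let ?z = "\<lambda>n. \<eta> * of_nat n + \<kappa>"
  define a where "a n = Mittag_Leffler_coeff \<sigma> c n * l ^ n * inverse (q_Gamma q (?z n))" for n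
  have powr_combine: "v powr p * (l * v powr \<eta>) ^ n = l ^ n * v powr (\<eta> * of_nat n + p)"
    if "v \<noteq> 0" for v p n
    using that by (simp add: power_mult_distrib powr_def algebra_simps flip: exp_of_nat_mult exp_add)
  have expand: "(\<lambda>n. a n * v powr (?z n - 1)) sums
      (v powr (\<kappa> - 1) * q_Mittag_Leffler q \<eta> \<kappa> \<sigma> c (l * v powr \<eta>))"
    if "v \<noteq> 0" "norm (l * v powr \<eta>) < (1 - q) powr (- Re \<eta>)" for v
  proof -
    have "v powr (\<kappa> - 1) * (Mittag_Leffler_coeff \<sigma> c n * ((l * v powr \<eta>) ^ n * inverse (q_Gamma q (?z n))))
        = a n * v powr (?z n - 1)" for n
      using powr_combine[OF that(1), of "\<kappa> - 1" n] by (auto simp: a_def algebra_simps)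
    with sums_mult[OF summable_sums[OF summable_q_Mittag_Leffler[OF assms(1,2) that(2), of c \<kappa>]],
        of "v powr (\<kappa> - 1)"]
    show ?thesis by (simp add: q_Mittag_Leffler_eq)
  qed
  have "(\<lambda>n. (a n * u powr (?z n - 1) - a n * (u * of_real q) powr (?z n - 1))
            / (u * of_real (1 - q)))
      sums q_diff q (\<lambda>v. v powr (\<kappa> - 1) * q_Mittag_Leffler q \<eta> \<kappa> \<sigma> c (l * v powr \<eta>)) u"
    unfolding q_diff_def using assms q_pos
    by (intro sums_divide sums_diff expand) auto
  \<comment> \<open>Here the factor produced by the power is absorbed into the reciprocal gamma value.\<close>
  moreover have "(a n * u powr (?z n - 1) - a n * (u * of_real q) powr (?z n - 1))
            / (u * of_real (1 - q))
      = u powr (\<kappa> - 1 - 1) * (Mittag_Leffler_coeff \<sigma> c n * ((l * u powr \<eta>) ^ n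
          * inverse (q_Gamma q (\<eta> * of_nat n + (\<kappa> - 1)))))" for n
  proof -
    have "(a n * u powr (?z n - 1) - a n * (u * of_real q) powr (?z n - 1)) / (u * of_real (1 - q))
        = a n * q_diff q (\<lambda>v. v powr (?z n - 1)) u"
      by (simp add: q_diff_def right_diff_distrib)
    also have "\<dots> = Mittag_Leffler_coeff \<sigma> c n * (l ^ n * u powr (?z n - 1 - 1))
        * inverse (q_Gamma q (?z n - 1))"
      unfolding q_diff_powr[OF assms(3)] inverse_q_Gamma_minus_1 a_def by (simp only: mult_ac)
    also have "l ^ n * u powr (?z n - 1 - 1) = u powr (\<kappa> - 1 - 1) * (l * u powr \<eta>) ^ n"
      using powr_combine[OF assms(3), of "\<kappa> - 1 - 1" n] by (simp add: add_diff_eq)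
    finally show ?thesis by (simp add: mult_ac add_diff_eq)
  qed
  moreover have "(\<lambda>n. u powr (\<kappa> - 1 - 1) * (Mittag_Leffler_coeff \<sigma> c n * ((l * u powr \<eta>) ^ n
          * inverse (q_Gamma q (\<eta> * of_nat n + (\<kappa> - 1))))))
      sums (u powr (\<kappa> - 1 - 1) * q_Mittag_Leffler q \<eta> (\<kappa> - 1) \<sigma> c (l * u powr \<eta>))"
    unfolding q_Mittag_Leffler_eq
    by (intro sums_mult summable_sums summable_q_Mittag_Leffler assms)
  ultimately show ?thesis by (simp only: sums_unique2)
qed

text \<open>The induction hypothesis is used at \<open>u\<close> and at \<open>u q\<close>, the two points at which the outermost
  operator evaluates its argument, so \<open>u\<close> has to vary.\<close>

lemma q_diff_funpow_q_Mittag_Leffler: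
  assumes "Re \<eta> \<ge> 0" "Re \<sigma> > 0" "u \<noteq> 0" "norm (l * u powr \<eta>) < (1 - q) powr (- Re \<eta>)"
  shows "(q_diff q ^^ m) (\<lambda>v. v powr (\<kappa> - 1) * q_Mittag_Leffler q \<eta> \<kappa> \<sigma> c (l * v powr \<eta>)) u
     = u powr (\<kappa> - of_nat m - 1) * q_Mittag_Leffler q \<eta> (\<kappa> - of_nat m) \<sigma> c (l * u powr \<eta>)"
  using assms(3,4)
proof (induction m arbitrary: u)
  case 0
  show ?case by simp
next
  case (Suc m)
  let ?f = "\<lambda>\<kappa> v. v powr (\<kappa> - 1) * q_Mittag_Leffler q \<eta> \<kappa> \<sigma> c (l * v powr \<eta>)"
  have "norm (l * (u * of_real q) powr \<eta>) = norm (l * u powr \<eta>) * q powr Re \<eta>"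
    using q_pos by (simp add: q_powr_mult norm_mult norm_powr_real_powr)
  also have "\<dots> \<le> norm (l * u powr \<eta>) * 1"
    using q_pos q_less_1 assms(1) by (intro mult_left_mono powr_le1) auto
  finally have uq: "norm (l * (u * of_real q) powr \<eta>) < (1 - q) powr (- Re \<eta>)"
    using Suc.prems(2) by simp
  have "(q_diff q ^^ Suc m) (?f \<kappa>) u = q_diff q ((q_diff q ^^ m) (?f \<kappa>)) u"
    by simp
  also have "\<dots> = q_diff q (?f (\<kappa> - of_nat m)) u"
    unfolding q_diff_def[of q _ u]
    using Suc.IH[OF Suc.prems] Suc.IH[OF _ uq] Suc.prems(1) q_pos by simp
  also have "\<dots> = u powr (\<kappa> - of_nat m - 1 - 1)
      * q_Mittag_Leffler q \<eta> (\<kappa> - of_nat m - 1) \<sigma> c (l * u powr \<eta>)"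
    by (rule q_diff_q_Mittag_Leffler[OF assms(1,2) Suc.prems uq])
  also have "\<kappa> - of_nat m - 1 = \<kappa> - of_nat (Suc m)" by simp
  finally show ?case .
qed

end

theorem theorem6p2:
  fixes q :: real and \<eta> \<kappa> \<sigma> c l u :: complex and m :: nat
  assumes "0 < q" and "q < 1"
    and "Re \<eta> > 0" and "Re \<kappa> > 0"
    and "Re c > Re \<sigma>" and "Re \<sigma> > 0"
    and "u \<noteq> 0"
    and "cmod (l * u powr \<eta>) < (1 - q) powr (- Re \<eta>)"
  shows "(q_diff q ^^ m)
           (\<lambda>v. v powr (\<kappa> - 1) * q_Mittag_Leffler q \<eta> \<kappa> \<sigma> c (l * v powr \<eta>)) u
         = u powr (\<kappa> - of_nat m - 1)
             * q_Mittag_Leffler q \<eta> (\<kappa> - of_nat m) \<sigma> c (l * u powr \<eta>)"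
  using assms by (intro q_diff_funpow_q_Mittag_Leffler) auto

end
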